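(* Let $(\vec d,\vec b)$ be an allocation with $c(\vec d,\vec b)<\infty$ and let $(\vec d^0,\vec b^0),(\vec d^1,\vec b^1),\dots,(\vec d^z,\vec b^z)$ be the allocations produced by the discrete gradient-descent algorithm initialized at $(\vec d,\vec b)$. Then for every $r\in\{1,\dots,z\}$ the allocation $(\vec d^r,\vec b^r)$ found in iteration $r$ minimizes the objective $c$ among all allocations at dock-move distance at most $r$ from $(\vec d,\vec b)$.
   Context: **Costs.** Stations are indexed by $[n]=\{1,\dots,n\}$; $D,B$ are nonnegative integers. For a finite sequence $X=(X_1,\dots,X_s)\in\{\pm1\}^s$ ($X_t=1$: attempted bike return, $X_t=-1$: attempted rental) and integers $d,b\ge 0$ let $\delta_0=d$, $\delta_t=\max\{0,\min\{d+b,\delta_{t-1}-X_t\}\}$ and $$c^X(d,b)=|\{t:X_t=1,\ \delta_{t-1}=0\}|+|\{t:X_t=-1,\ \delta_{t-1}=d+b\}|.$$ Each station $i$ has a probability distribution $p_i$ on finite $\pm1$ sequences and integers $0\le l_i\le u_i$, and $c_i(d,b)=\mathbb E_{X\sim p_i}[c^X(d,b)]$ if $d,b\ge0$ and $l_i\le d+b\le u_i$, while $c_i(d,b)=\infty$ for all other $(d,b)\in\mathbb Z^2$. (One station may be a "depot" station, for which instead $c_i(d,b)=d+b-l_i$ on the same kind of domain and $\infty$ elsewhere.) The objective is $c(\vec d,\vec b)=\sum_i c_i(d_i,b_i)$. **Allocations.** An allocation is a pair $(\vec d,\vec b)\in\mathbb Z^n\times\mathbb Z^n$ with $\sum_i(d_i+b_i)=D+B$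 and $\sum_i b_i=B$. The dock-move distance between $(\vec d,\vec b)$ and $(\vec d',\vec b')$ is $|\vec d+\vec b-\vec d'-\vec b'|_1/2$. An allocation is bike-optimal if it minimizes $c$ among all allocations $(\vec d',\vec b')$ with $d'_i+b'_i=d_i+b_i$ for all $i$. **Dock-moves.** With unit vectors $e_i$, for stations $i\ne j$ and a station $h$: $o_{ij}(\vec d,\vec b)=(\vec d-e_i+e_j,\vec b)$; $e_{ij}(\vec d,\vec b)=(\vec d,\vec b-e_i+e_j)$; $E_{ijh}(\vec d,\vec b)=(\vec d-e_i+e_h,\vec b+e_j-e_h)$; $O_{ijh}(\vec d,\vec b)=(\vec d+e_j-e_h,\vec b-e_i+e_h)$. The neighborhood $N(\vec d,\vec b)$ is the set of all allocations obtained from $(\vec d,\vec b)$ by one such transformation. **Discrete gradient-descent algorithm** (input $(\vec d,\vec b)$ and a positive integer $z$). First compute a bike-optimal allocation $(\vec d^0,\vec b^0)$ with $d^0_i+b^0_i=d_i+b_i$ for all $i$. For $r=1,\dots,z$: let $(\vec d',\vec b')$ be a minimizer of $c$ over $N(\vec d^{r-1},\vec b^{r-1})$; if $c(\vec d',\vec b')<c(\vec d^{r-1},\vec b^{r-1})$, set $(\vec d^r,\vec b^r)=(\vec d',\vec b')$; otherwise the algorithm stops and returns $(\vec d^{r-1},\vec b^{r-1})$, in which case $(\vec d^{s},\vec b^{s})$ is understood to be $(\vec d^{r-1},\vec b^{r-1})$ for all $s\ge r$. *)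

theory Defs
  imports "HOL-Probability.Probability"
begin

text \<open>
  A demand sequence is a list with entries \<open>1\<close> (attempted return) and \<open>-1\<close> (attempted rental).
  List positions start at \<open>0\<close>, so the event usually written \<open>X\<^sub>t\<close> (\<open>t \<ge> 1\<close>) is \<open>X ! (t - 1)\<close>.
\<close>

primrec open_docks :: "int list \<Rightarrow> int \<Rightarrow> int \<Rightarrow> nat \<Rightarrow> int" where
  "open_docks X d b 0 = d"
| "open_docks X d b (Suc t) = max 0 (min (d + b) (open_docks X d b t - X ! t))"

definition sequence_cost :: "int list \<Rightarrow> int \<Rightarrow> int \<Rightarrow> nat" where
  "sequence_cost X d b =
     card {t. t < length X \<and> X ! t = 1 \<and> open_docks X d b t = 0}
   + card {t. t < length X \<and> X ! t = -1 \<and> open_docks X d b t = d + b}"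

definition station_domain :: "int \<Rightarrow> int \<Rightarrow> int \<Rightarrow> int \<Rightarrow> bool" where
  "station_domain l u d b \<longleftrightarrow> 0 \<le> d \<and> 0 \<le> b \<and> l \<le> d + b \<and> d + b \<le> u"

text \<open>
  All costs are nonnegative, so they take values in \<^typ>\<open>ennreal\<close>. The distribution may have
  infinite support; the expectation is then allowed to be infinite.
\<close>

definition station_cost :: "int list pmf \<Rightarrow> int \<Rightarrow> int \<Rightarrow> int \<Rightarrow> int \<Rightarrow> ennreal" where
  "station_cost q l u d b =
     (if station_domain l u d b
      then \<integral>\<^sup>+ X. of_nat (sequence_cost X d b) \<partial>measure_pmf q
      else \<infinity>)"

definition depot_cost :: "int \<Rightarrow> int \<Rightarrow> int \<Rightarrow> int \<Rightarrow> ennreal" where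
  "depot_cost l u d b =
     (if station_domain l u d b then ennreal (real_of_int (d + b - l)) else \<infinity>)"

type_synonym 'n alloc = "(int ^ 'n) \<times> (int ^ 'n)"

text \<open>
  The stations are the elements of the finite type \<^typ>\<open>'n\<close>. The argument \<open>depot\<close> is \<open>None\<close> if there
  is no depot; the distribution of a depot station is ignored.
\<close>

definition objective ::
  "('n::finite \<Rightarrow> int list pmf) \<Rightarrow> ('n \<Rightarrow> int) \<Rightarrow> ('n \<Rightarrow> int) \<Rightarrow> 'n option \<Rightarrow> 'n alloc \<Rightarrow> ennreal"
where
  "objective p l u depot = (\<lambda>(d, b). \<Sum>i\<in>UNIV.
     if depot = Some i then depot_cost (l i) (u i) (d $ i) (b $ i)
     else station_cost (p i) (l i) (u i) (d $ i) (b $ i))"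

definition allocations :: "nat \<Rightarrow> nat \<Rightarrow> ('n::finite) alloc set" where
  "allocations D B =
     {(d, b). (\<Sum>i\<in>UNIV. d $ i + b $ i) = int (D + B) \<and> (\<Sum>i\<in>UNIV. b $ i) = int B}"

definition dock_total :: "('n::finite) alloc \<Rightarrow> int ^ 'n" where
  "dock_total = (\<lambda>(d, b). d + b)"

definition dock_move_distance :: "('n::finite) alloc \<Rightarrow> 'n alloc \<Rightarrow> real" where
  "dock_move_distance x y =
     real_of_int (\<Sum>i\<in>UNIV. \<bar>dock_total x $ i - dock_total y $ i\<bar>) / 2"

definition bike_optimal ::
  "(('n::finite) alloc \<Rightarrow> ennreal) \<Rightarrow> nat \<Rightarrow> nat \<Rightarrow> 'n alloc \<Rightarrow> bool"
where
  "bike_optimal c D B x \<longleftrightarrow>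
     is_arg_min c (\<lambda>y. y \<in> allocations D B \<and> dock_total y = dock_total x) x"

definition move_o :: "'n \<Rightarrow> 'n \<Rightarrow> ('n::finite) alloc \<Rightarrow> 'n alloc" where
  "move_o i j = (\<lambda>(d, b). (d - axis i 1 + axis j 1, b))"

definition move_e :: "'n \<Rightarrow> 'n \<Rightarrow> ('n::finite) alloc \<Rightarrow> 'n alloc" where
  "move_e i j = (\<lambda>(d, b). (d, b - axis i 1 + axis j 1))"

definition move_E :: "'n \<Rightarrow> 'n \<Rightarrow> 'n \<Rightarrow> ('n::finite) alloc \<Rightarrow> 'n alloc" where
  "move_E i j h = (\<lambda>(d, b). (d - axis i 1 + axis h 1, b + axis j 1 - axis h 1))"

definition move_O :: "'n \<Rightarrow> 'n \<Rightarrow> 'n \<Rightarrow> ('n::finite) alloc \<Rightarrow> 'n alloc" where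
  "move_O i j h = (\<lambda>(d, b). (d + axis j 1 - axis h 1, b - axis i 1 + axis h 1))"

text \<open>The station \<open>h\<close> may coincide with \<open>i\<close> or \<open>j\<close>; this only reproduces \<open>move_o\<close> and \<open>move_e\<close>.\<close>

definition neighborhood :: "nat \<Rightarrow> nat \<Rightarrow> ('n::finite) alloc \<Rightarrow> 'n alloc set" where
  "neighborhood D B x =
     {y \<in> allocations D B. \<exists>i j. i \<noteq> j \<and>
        (y = move_o i j x \<or> y = move_e i j x \<or> (\<exists>h. y = move_E i j h x \<or> y = move_O i j h x))}"

text \<open>
  The minimizer chosen in an iteration need not be unique, so an iteration is a relation.
  Once no minimizer over the neighborhood improves the objective, the allocation stays
  the same in this and all later iterations; this covers termination, also when the
  neighborhood is empty (a single station).
\<close>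

definition descent_step ::
  "(('n::finite) alloc \<Rightarrow> ennreal) \<Rightarrow> nat \<Rightarrow> nat \<Rightarrow> 'n alloc \<Rightarrow> 'n alloc \<Rightarrow> bool"
where
  "descent_step c D B x y \<longleftrightarrow>
     (if \<exists>y'. is_arg_min c (\<lambda>w. w \<in> neighborhood D B x) y' \<and> c y' < c x
      then is_arg_min c (\<lambda>w. w \<in> neighborhood D B x) y \<and> c y < c x
      else y = x)"

definition gradient_descent_run ::
  "(('n::finite) alloc \<Rightarrow> ennreal) \<Rightarrow> nat \<Rightarrow> nat \<Rightarrow> 'n alloc \<Rightarrow> nat \<Rightarrow> (nat \<Rightarrow> 'n alloc) \<Rightarrow> bool"
where
  "gradient_descent_run c D B x0 z x \<longleftrightarrow>
     bike_optimal c D B (x 0) \<and> dock_total (x 0) = dock_total x0 \<and>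
     (\<forall>r\<in>{1..z}. descent_step c D B (x (r - 1)) (x r))"

end

theory Submission
  imports Defs
begin

text \<open>
  Write \<open>q = d + b\<close> for the number of docks of a station. For every single demand sequence the cost
  is a multimodular function of \<open>(d, b)\<close>: it satisfies the three local inequalities that express
  M-natural-convexity in the plane. In the three coordinates \<open>d\<close>, \<open>b\<close> and \<open>- q\<close>, whose sum is \<open>0\<close>,
  these inequalities yield exchange inequalities: two pairs \<open>x\<close> and \<open>y\<close> can both be moved one unit
  towards each other, in any pair of coordinates in which they differ in opposite directions,
  without increasing the sum of their costs. Which move is possible depends only on the signs of
  the differences and never on the demand sequence. Hence the inequalities survive the
  expectation, even where it is infinite, and they survive the restriction to the domain, since the
  moved pairs stay in the coordinate box spanned by \<open>x\<close> and \<open>y\<close>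
  (\<open>exchangeable_integral_on_domain\<close>).

  For two allocations \<open>x\<close> and \<open>y\<close> and a station \<open>i\<close> with fewer docks in \<open>x\<close> than in \<open>y\<close>, the exchanges
  of individual stations can be chained. Give \<open>i\<close> one unit, say an open dock; take it from a
  station \<open>h\<close> with too many open docks; if \<open>h\<close> wants a bike in return, take that bike from a station
  \<open>j\<close> with too many bikes. Either the chain ends at a station that has more docks in \<open>x\<close> than in
  \<open>y\<close>, and then \<open>x\<close> has made one of the dock-moves \<open>o\<close>, \<open>e\<close>, \<open>E\<close>, \<open>O\<close>; or its last two links form a
  swap between \<open>h\<close> and \<open>j\<close> that leaves all dock totals unchanged (\<open>allocation_exchange\<close>).
  This is why neighborhoods that involve at most three stations suffice.

  Let \<open>x\<close> be optimal in the ball of radius \<open>r\<close> around the initial allocation, and \<open>y\<close> arbitrary in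
  the ball of radius \<open>r + 1\<close>. If \<open>y\<close> lies outside the smaller ball, choose \<open>i\<close> such that \<open>y\<close> has more
  docks there than both \<open>x\<close> and the initial allocation. The exchange produces \<open>x'\<close> and \<open>y'\<close> with
  \<open>c x' + c y' \<le> c x + c y\<close>. If \<open>y'\<close> lies in the smaller ball, then \<open>c x \<le> c y'\<close>, so the neighbor
  \<open>x'\<close> of \<open>x\<close> is at least as good as \<open>y\<close>. Otherwise \<open>x'\<close> lies in the smaller ball, so
  \<open>c x \<le> c x'\<close> and \<open>y'\<close> is at least as good as \<open>y\<close> but closer to \<open>x\<close>. By induction on the distance
  from \<open>x\<close>, some element of \<open>{x} \<union> N(x)\<close> is optimal in the larger ball
  (\<open>neighborhood_improves_ball\<close>), which is exactly what an iteration finds.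
\<close>

section \<open>Multimodularity of the cost of a demand sequence\<close>

lemma card_less_Suc_split:
  "card {t. t < Suc n \<and> P t} = of_bool (P 0) + card {t. t < n \<and> P (Suc t)}"
proof -
  have "{t. t < Suc n \<and> P t} = (if P 0 then {0} else {}) \<union> Suc ` {t. t < n \<and> P (Suc t)}"
    by (auto simp: image_iff less_Suc_eq_0_disj)
  moreover have "card (Suc ` {t. t < n \<and> P (Suc t)}) = card {t. t < n \<and> P (Suc t)}"
    by (rule card_image) auto
  ultimately show ?thesis
    by (auto simp: card_insert_if)
qed

lemma open_docks_Cons:
  "open_docks (a # X) d b (Suc t) =
   open_docks X (max 0 (min (d + b) (d - a))) (d + b - max 0 (min (d + b) (d - a))) t"
  by (induction t) auto

lemma sequence_cost_Cons:
  "sequence_cost (a # X) d b =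
     of_bool (a = 1 \<and> d = 0) + of_bool (a = - 1 \<and> b = 0) +
     sequence_cost X (max 0 (min (d + b) (d - a))) (d + b - max 0 (min (d + b) (d - a)))"
  unfolding sequence_cost_def length_Cons card_less_Suc_split open_docks_Cons
  by simp

lemma sequence_cost_return:
  assumes "0 \<le> d" "0 \<le> b"
  shows "sequence_cost (1 # X) d b =
    (if d = 0 then 1 + sequence_cost X 0 b else sequence_cost X (d - 1) (b + 1))"
  using assms by (auto simp: sequence_cost_Cons max_def min_def)

lemma sequence_cost_rental:
  assumes "0 \<le> d" "0 \<le> b"
  shows "sequence_cost (- 1 # X) d b =
    (if b = 0 then 1 + sequence_cost X d 0 else sequence_cost X (d + 1) (b - 1))"
proof -
  have "max 0 (min (d + b) (d + 1)) = (if b = 0 then d else d + 1)"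
    using assms by (simp add: max_def min_def)
  with assms show ?thesis
    by (simp add: sequence_cost_Cons)
qed

text \<open>
  The first inequality is supermodularity, that is, it belongs to the pair of directions
  \<open>(1, 0)\<close>, \<open>(0, 1)\<close>; the other two belong to the pairs \<open>(1, 0)\<close>, \<open>(1, - 1)\<close> and \<open>(0, 1)\<close>, \<open>(- 1, 1)\<close>.
  They are written such that all points lie in the nonnegative quadrant.
\<close>

definition multimodular :: "(int \<Rightarrow> int \<Rightarrow> int) \<Rightarrow> bool" where
  "multimodular F \<longleftrightarrow> (\<forall>d\<ge>0. \<forall>b\<ge>0.
     F (d + 1) b + F d (b + 1) \<le> F d b + F (d + 1) (b + 1) \<and>
     F (d + 1) b + F (d + 1) (b + 1) \<le> F d (b + 1) + F (d + 2) b \<and>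
     F d (b + 1) + F (d + 1) (b + 1) \<le> F (d + 1) b + F d (b + 2))"

text \<open>
  Multimodularity alone does not carry over from a sequence to a longer one: at an empty or a full
  station the new first event costs 1, which has to be weighed against the cost of replacing one
  open dock by a bike. This bound makes the induction work.
\<close>

definition swap_lipschitz :: "(int \<Rightarrow> int \<Rightarrow> int) \<Rightarrow> bool" where
  "swap_lipschitz F \<longleftrightarrow> (\<forall>d\<ge>0. \<forall>b\<ge>0. \<bar>F (d + 1) b - F d (b + 1)\<bar> \<le> 1)"

text \<open>
  Adding two of the local inequalities that share a pair of points cancels these and leaves
  convexity along an axis.
\<close>

lemma multimodular_convex:
  assumes "multimodular F" "0 \<le> d" "0 \<le> b"
  shows "2 * F d (b + 1) \<le> F d b + F d (b + 2)"
  using assms unfolding multimodular_def by (smt (verit))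

text \<open>
  A first event that is an attempted return shifts the argument by \<open>(- 1, 1)\<close>, under which all
  inequalities are invariant, except on the boundary \<open>d = 0\<close>. There supermodularity of \<open>G\<close> turns
  into convexity of \<open>F\<close> in \<open>b\<close>, and the second inequality into the Lipschitz bound.
\<close>

lemma multimodular_prepend_return:
  assumes M: "multimodular F" and L: "swap_lipschitz F"
    and G: "\<And>d b. 0 \<le> d \<Longrightarrow> 0 \<le> b \<Longrightarrow> G d b = (if d = 0 then 1 + F 0 b else F (d - 1) (b + 1))"
  shows "multimodular G" "swap_lipschitz G"
proof -
  have eq0: "G 0 b = 1 + F 0 b" "G 1 b = F 0 (b + 1)" "G 2 b = F 1 (b + 1)" if "0 \<le> b" for b
    using that by (simp_all add: G)
  have loc: "F (d + 1) b + F d (b + 1) \<le> F d b + F (d + 1) (b + 1)"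
     "F (d + 1) b + F (d + 1) (b + 1) \<le> F d (b + 1) + F (d + 2) b"
     "F d (b + 1) + F (d + 1) (b + 1) \<le> F (d + 1) b + F d (b + 2)"
     "\<bar>F (d + 1) b - F d (b + 1)\<bar> \<le> 1" if "0 \<le> d" "0 \<le> b" for d b
    using M L that unfolding multimodular_def swap_lipschitz_def by blast+
  have "G (d + 1) b + G d (b + 1) \<le> G d b + G (d + 1) (b + 1) \<and>
     G (d + 1) b + G (d + 1) (b + 1) \<le> G d (b + 1) + G (d + 2) b \<and>
     G d (b + 1) + G (d + 1) (b + 1) \<le> G (d + 1) b + G d (b + 2) \<and>
     \<bar>G (d + 1) b - G d (b + 1)\<bar> \<le> 1" if "0 \<le> d" "0 \<le> b" for d b
  proof (cases "d = 0")
    case True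
    with that show ?thesis
      using multimodular_convex[OF M, of 0 b] loc(4)[of 0 "b + 1"]
      by (simp add: eq0 add.assoc)
  next
    case False
    with that have "G (d + 1) b = F d (b + 1)" "G d (b + 1) = F (d - 1) (b + 2)"
      "G d b = F (d - 1) (b + 1)" "G (d + 1) (b + 1) = F d (b + 2)"
      "G (d + 2) b = F (d + 1) (b + 1)" "G d (b + 2) = F (d - 1) (b + 3)"
      by (simp_all add: G add.commute)
    with that False show ?thesis
      using loc[of "d - 1" "b + 1"] by (simp add: algebra_simps)
  qed
  then show "multimodular G" "swap_lipschitz G"
    unfolding multimodular_def swap_lipschitz_def by blast+
qed

lemma multimodular_swap: "multimodular F \<Longrightarrow> multimodular (\<lambda>d b. F b d)"
  unfolding multimodular_def by (smt (verit))

lemma swap_lipschitz_swap: "swap_lipschitz F \<Longrightarrow> swap_lipschitz (\<lambda>d b. F b d)"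
  unfolding swap_lipschitz_def by (smt (verit))

text \<open>
  An attempted rental acts like an attempted return with the roles of open docks and bikes
  interchanged, so both events are instances of the same step.
\<close>

lemma multimodular_sequence_cost:
  assumes "set X \<subseteq> {1, - 1}"
  shows "multimodular (\<lambda>d b. int (sequence_cost X d b)) \<and>
         swap_lipschitz (\<lambda>d b. int (sequence_cost X d b))"
  using assms
proof (induction X)
  case Nil
  then show ?case
    by (simp add: sequence_cost_def multimodular_def swap_lipschitz_def)
next
  case (Cons a X)
  let ?F = "\<lambda>d b. int (sequence_cost X d b)"
  let ?G = "\<lambda>d b. int (sequence_cost (a # X) d b)"
  have IH: "multimodular ?F" "swap_lipschitz ?F"
    using Cons by auto
  from Cons.prems consider "a = 1" | "a = - 1"
    by auto
  then show ?case
  proof cases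
    case 1
    have "?G d b = (if d = 0 then 1 + ?F 0 b else ?F (d - 1) (b + 1))"
      if "0 \<le> d" "0 \<le> b" for d b
      using that 1 by (simp add: sequence_cost_return)
    with multimodular_prepend_return[OF IH, of ?G] show ?thesis
      by blast
  next
    case 2
    have "?G b d = (if d = 0 then 1 + ?F b 0 else ?F (b + 1) (d - 1))"
      if "0 \<le> d" "0 \<le> b" for d b
      using that 2 by (simp add: sequence_cost_rental)
    with multimodular_prepend_return[OF multimodular_swap[OF IH(1)] swap_lipschitz_swap[OF IH(2)],
        of "\<lambda>d b. ?G b d"]
    have "multimodular (\<lambda>d b. ?G b d)" "swap_lipschitz (\<lambda>d b. ?G b d)"
      by blast+
    then show ?thesis
      using multimodular_swap[of "\<lambda>d b. ?G b d"] swap_lipschitz_swap[of "\<lambda>d b. ?G b d"] by simp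
  qed
qed

section \<open>Exchange inequalities for a single station\<close>

lemma int_chain_mono:
  fixes g :: "int \<Rightarrow> int"
  assumes "m \<le> n" and "\<And>k. m \<le> k \<Longrightarrow> k < n \<Longrightarrow> g k \<le> g (k + 1)"
  shows "g m \<le> g n"
  using assms
proof (induction n rule: int_ge_induct)
  case (step n)
  then show ?case by (smt (verit))
qed simp

text \<open>
  The claim says that the difference \<open>G\<close> in direction \<open>(1, 0)\<close> is smaller at \<open>(d, b)\<close> than at
  \<open>(d' - 1, b')\<close>. Two of the local inequalities say that \<open>G\<close> increases with \<open>d + b\<close> for fixed \<open>d\<close> and
  with \<open>d\<close> for fixed \<open>d + b\<close>, and both coordinates increase between these points. The path raises
  \<open>d + b\<close> first, since it might otherwise leave the quadrant.
\<close>

lemma multimodular_exchange_dock: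
  assumes M: "multimodular F" and nonneg: "0 \<le> d" "0 \<le> b" "0 \<le> b'"
    and less: "d < d'" "d + b < d' + b'"
  shows "F (d + 1) b + F (d' - 1) b' \<le> F d b + F d' b'"
proof -
  define G where "G d b = F (d + 1) b - F d b" for d b
  have up: "G d b \<le> G d (b + 1)" "G d (b + 1) \<le> G (d + 1) b" if "0 \<le> d" "0 \<le> b" for d b
    using M that unfolding multimodular_def G_def by (smt (verit))+
  define q where "q = d' - 1 + b'"
  have "G d b \<le> G d (q - d)"
    by (rule int_chain_mono[where g = "G d"]) (use nonneg less up in \<open>auto simp: q_def\<close>)
  also have "G d (q - d) \<le> G (d' - 1) (q - (d' - 1))"
  proof (rule int_chain_mono[where g = "\<lambda>k. G k (q - k)"])
    fix k assume "d \<le> k" "k < d' - 1"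
    then show "G k (q - k) \<le> G (k + 1) (q - (k + 1))"
      using up(2)[of k "q - k - 1"] nonneg by (simp add: q_def algebra_simps)
  qed (use less in simp)
  finally show ?thesis
    by (simp add: G_def q_def)
qed

text \<open>
  The same argument for the difference between \<open>(d + 1, b)\<close> and \<open>(d, b + 1)\<close>, which increases with
  \<open>d\<close> and decreases with \<open>b\<close>.
\<close>

lemma multimodular_exchange_swap:
  assumes M: "multimodular F" and nonneg: "0 \<le> d'" "0 \<le> b"
    and less: "d' < d" "b < b'"
  shows "F (d - 1) (b + 1) + F (d' + 1) (b' - 1) \<le> F d b + F d' b'"
proof -
  define W where "W d b = F (d + 1) b - F d (b + 1)" for d b
  have up: "W d b \<le> W (d + 1) b" "W d (b + 1) \<le> W d b" if "0 \<le> d" "0 \<le> b" for d b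
    using M that unfolding multimodular_def W_def by (smt (verit))+
  have "W d' (b' - 1) \<le> W (d - 1) (b' - 1)"
    by (rule int_chain_mono[where g = "\<lambda>k. W k (b' - 1)"]) (use nonneg less up in auto)
  moreover have "- W (d - 1) b \<le> - W (d - 1) (b' - 1)"
    by (rule int_chain_mono[where g = "\<lambda>k. - W (d - 1) k"]) (use nonneg less up in auto)
  ultimately show ?thesis
    by (simp add: W_def)
qed

text \<open>
  The M-convex exchange property in the coordinates \<open>d\<close>, \<open>b\<close>, \<open>- (d + b)\<close>, in the strong form in
  which every pair of coordinates with differences of opposite signs admits an exchange. The cases
  with \<open>(d, b)\<close> and \<open>(d', b')\<close> interchanged are covered by the quantifiers.
\<close>

definition exchangeable :: "(int \<Rightarrow> int \<Rightarrow> ennreal) \<Rightarrow> bool" where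
  "exchangeable f \<longleftrightarrow> (\<forall>d b d' b'.
     (d < d' \<and> d + b < d' + b' \<longrightarrow> f (d + 1) b + f (d' - 1) b' \<le> f d b + f d' b') \<and>
     (b < b' \<and> d + b < d' + b' \<longrightarrow> f d (b + 1) + f d' (b' - 1) \<le> f d b + f d' b') \<and>
     (d' < d \<and> b < b' \<longrightarrow> f (d - 1) (b + 1) + f (d' + 1) (b' - 1) \<le> f d b + f d' b'))"

lemma exchangeable_swap: "exchangeable f \<Longrightarrow> exchangeable (\<lambda>d b. f b d)"
  unfolding exchangeable_def by (metis add.commute)

text \<open>
  The direction of the exchange is the same for all \<open>X\<close>, so the inequalities can be integrated.
  Outside the domain the right-hand side is infinite. Inside, the domain bounds \<open>d\<close>, \<open>b\<close> and
  \<open>d + b\<close>, and an exchange keeps each of them between the two values that it had before.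
\<close>

lemma exchangeable_integral_on_domain:
  fixes F :: "'a \<Rightarrow> int \<Rightarrow> int \<Rightarrow> nat" and q :: "'a pmf"
  assumes M: "\<And>X. X \<in> set_pmf q \<Longrightarrow> multimodular (\<lambda>d b. int (F X d b))"
  shows "exchangeable (\<lambda>d b. if station_domain l u d b
           then \<integral>\<^sup>+ X. of_nat (F X d b) \<partial>measure_pmf q else \<infinity>)" (is "exchangeable ?f")
proof -
  have integrate: "?f d1 b1 + ?f d2 b2 \<le> ?f d b + ?f d' b'"
    if le: "\<And>X. \<lbrakk>X \<in> set_pmf q; station_domain l u d b; station_domain l u d' b'\<rbrakk> \<Longrightarrow>
          int (F X d1 b1) + int (F X d2 b2) \<le> int (F X d b) + int (F X d' b')"
      and dom: "\<lbrakk>station_domain l u d b; station_domain l u d' b'\<rbrakk> \<Longrightarrow>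
          station_domain l u d1 b1 \<and> station_domain l u d2 b2"
    for d b d' b' d1 b1 d2 b2
  proof (cases "station_domain l u d b \<and> station_domain l u d' b'")
    case True
    then have "(\<integral>\<^sup>+ X. of_nat (F X d1 b1) \<partial>measure_pmf q) + (\<integral>\<^sup>+ X. of_nat (F X d2 b2) \<partial>measure_pmf q)
       = (\<integral>\<^sup>+ X. of_nat (F X d1 b1 + F X d2 b2) \<partial>measure_pmf q)"
      by (simp add: nn_integral_add)
    also have "\<dots> \<le> (\<integral>\<^sup>+ X. of_nat (F X d b + F X d' b') \<partial>measure_pmf q)"
    proof (rule nn_integral_mono_AE, rule AE_pmfI)
      fix X assume "X \<in> set_pmf q"
      then have "F X d1 b1 + F X d2 b2 \<le> F X d b + F X d' b'"
        using le[of X] True by linarith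
      then show "(of_nat (F X d1 b1 + F X d2 b2) :: ennreal) \<le> of_nat (F X d b + F X d' b')"
        by (rule of_nat_mono)
    qed
    also have "\<dots> = (\<integral>\<^sup>+ X. of_nat (F X d b) \<partial>measure_pmf q) + (\<integral>\<^sup>+ X. of_nat (F X d' b') \<partial>measure_pmf q)"
      by (simp add: nn_integral_add)
    finally show ?thesis
      using dom True by simp
  qed auto
  show ?thesis
    unfolding exchangeable_def
  proof (intro allI conjI impI)
    fix d b d' b' :: int
    assume "d < d' \<and> d + b < d' + b'"
    then show "?f (d + 1) b + ?f (d' - 1) b' \<le> ?f d b + ?f d' b'"
      using multimodular_exchange_dock[OF M, of _ d b b' d']
      by (intro integrate) (auto simp: station_domain_def)
  next
    fix d b d' b' :: int
    assume "b < b' \<and> d + b < d' + b'"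
    then show "?f d (b + 1) + ?f d' (b' - 1) \<le> ?f d b + ?f d' b'"
      using multimodular_exchange_dock[OF multimodular_swap[OF M], of _ b d d' b']
      by (intro integrate) (auto simp: station_domain_def)
  next
    fix d b d' b' :: int
    assume "d' < d \<and> b < b'"
    then show "?f (d - 1) (b + 1) + ?f (d' + 1) (b' - 1) \<le> ?f d b + ?f d' b'"
      using multimodular_exchange_swap[OF M, of _ d' b d b']
      by (intro integrate) (auto simp: station_domain_def)
  qed
qed

lemma exchangeable_station_cost:
  assumes "\<And>X. X \<in> set_pmf q \<Longrightarrow> set X \<subseteq> {1, - 1}"
  shows "exchangeable (station_cost q l u)"
  using exchangeable_integral_on_domain[of q sequence_cost l u] multimodular_sequence_cost assms
  unfolding station_cost_def by blast

text \<open>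
  On its domain the depot cost is \<open>max 0 (d + b - l)\<close>, a convex function of \<open>d + b\<close>. It
  becomes a special case of \<open>exchangeable_integral_on_domain\<close> as an expectation over a one-point distribution.
\<close>

lemma exchangeable_depot_cost: "exchangeable (depot_cost l u)"
proof -
  have "depot_cost l u =
      (\<lambda>d b. if station_domain l u d b
        then \<integral>\<^sup>+ X. of_nat (nat (d + b - l)) \<partial>measure_pmf (return_pmf ()) else \<infinity>)"
    by (auto simp: fun_eq_iff depot_cost_def station_domain_def ennreal_of_nat_eq_real_of_nat)
  moreover have "multimodular (\<lambda>d b. int (nat (d + b - l)))"
    unfolding multimodular_def by auto
  ultimately show ?thesis
    using exchangeable_integral_on_domain[of "return_pmf ()" "\<lambda>_ d b. nat (d + b - l)" l u]
    by simp
qed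

section \<open>Exchange inequalities for allocations\<close>

text \<open>
  Moving \<open>(d, b)\<close> by \<open>(\<alpha>, \<beta>)\<close> and \<open>(d', b')\<close> by the opposite vector increases the joint cost of the
  two allocations at no station and brings them closer to each other. All conditions concern single
  stations, so that each can be checked from the exchange inequality of that station.
\<close>

definition exchange_direction ::
  "('n \<Rightarrow> int \<Rightarrow> int \<Rightarrow> ennreal) \<Rightarrow> int ^ 'n \<Rightarrow> int ^ 'n \<Rightarrow> int ^ 'n \<Rightarrow> int ^ 'n \<Rightarrow>
   int ^ 'n \<Rightarrow> int ^ 'n \<Rightarrow> bool"
where
  "exchange_direction f d b d' b' \<alpha> \<beta> \<longleftrightarrow>
     (\<forall>t. f t (d $ t + \<alpha> $ t) (b $ t + \<beta> $ t) + f t (d' $ t - \<alpha> $ t) (b' $ t - \<beta> $ t)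
            \<le> f t (d $ t) (b $ t) + f t (d' $ t) (b' $ t)) \<and>
     (\<forall>t. \<bar>d' $ t - \<alpha> $ t - d $ t\<bar> + \<bar>b' $ t - \<beta> $ t - b $ t\<bar> \<le>
          \<bar>d' $ t - d $ t\<bar> + \<bar>b' $ t - b $ t\<bar>) \<and>
     (\<exists>t. \<bar>d' $ t - \<alpha> $ t - d $ t\<bar> + \<bar>b' $ t - \<beta> $ t - b $ t\<bar> <
          \<bar>d' $ t - d $ t\<bar> + \<bar>b' $ t - b $ t\<bar>)"

lemma exchange_direction_swap:
  "exchange_direction (\<lambda>t d b. f t b d) b d b' d' \<beta> \<alpha> \<longleftrightarrow> exchange_direction f d b d' b' \<alpha> \<beta>"
  unfolding exchange_direction_def by (simp add: add.commute)

lemma exists_less_if_sum_less: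
  fixes g h :: "'n::finite \<Rightarrow> int"
  assumes "sum g UNIV < sum h UNIV"
  shows "\<exists>j. g j < h j"
proof (rule ccontr)
  assume "\<not> ?thesis"
  then have "sum h UNIV \<le> sum g UNIV"
    by (intro sum_mono) (simp add: not_less)
  with assms show False by simp
qed

lemma exists_greater_if_sum_eq:
  fixes g h :: "'n::finite \<Rightarrow> int"
  assumes "sum g UNIV = sum h UNIV" "g i < h i"
  shows "\<exists>j. h j < g j"
proof (rule ccontr)
  assume "\<not> ?thesis"
  then have "\<And>j. g j \<le> h j"
    by (simp add: not_less)
  then have "sum g UNIV < sum h UNIV"
    using assms(2) by (intro sum_strict_mono_ex1) auto
  with assms(1) show False by simp
qed

text \<open>
  The chain of exchanges that starts with an open dock for \<open>i\<close>. The station \<open>h\<close> gives up an open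
  dock; if it has no docks to spare, it must take a bike instead, and \<open>j\<close> gives up a bike. If \<open>j\<close>
  has docks to spare, the chain ends there. Otherwise \<open>j\<close> takes an open dock for its bike, and the
  exchanges of \<open>h\<close> and \<open>j\<close> balance each other without \<open>i\<close>; in this case \<open>j\<close> may coincide with \<open>i\<close>.
\<close>

lemma exchange_from_open_dock:
  fixes d b d' b' :: "int ^ 'n::finite"
  assumes f: "\<And>t. exchangeable (f t)"
    and sum_d: "(\<Sum>t\<in>UNIV. d $ t) = (\<Sum>t\<in>UNIV. d' $ t)"
    and sum_b: "(\<Sum>t\<in>UNIV. b $ t) = (\<Sum>t\<in>UNIV. b' $ t)"
    and i: "d $ i < d' $ i" "d $ i + b $ i < d' $ i + b' $ i"
  shows "\<exists>\<alpha> \<beta>. exchange_direction f d b d' b' \<alpha> \<beta> \<and>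
    ((\<exists>j h. \<alpha> = axis j 1 - axis h 1 \<and> \<beta> = axis h 1 - axis j 1) \<or>
     (\<exists>j. d' $ j + b' $ j < d $ j + b $ j \<and>
       (\<alpha> = axis i 1 - axis j 1 \<and> \<beta> = 0 \<or>
        (\<exists>h. \<alpha> = axis i 1 - axis h 1 \<and> \<beta> = axis h 1 - axis j 1))))"
proof -
  have dock: "f t (d $ t + 1) (b $ t) + f t (d' $ t - 1) (b' $ t)
       \<le> f t (d $ t) (b $ t) + f t (d' $ t) (b' $ t)"
    if "d $ t < d' $ t" "d $ t + b $ t < d' $ t + b' $ t" for t
    using f[of t] that unfolding exchangeable_def by blast
  have dock': "f t (d $ t - 1) (b $ t) + f t (d' $ t + 1) (b' $ t)
       \<le> f t (d $ t) (b $ t) + f t (d' $ t) (b' $ t)"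
    if "d' $ t < d $ t" "d' $ t + b' $ t < d $ t + b $ t" for t
    using f[of t] that unfolding exchangeable_def by (metis add.commute)
  have bike': "f t (d $ t) (b $ t - 1) + f t (d' $ t) (b' $ t + 1)
       \<le> f t (d $ t) (b $ t) + f t (d' $ t) (b' $ t)"
    if "b' $ t < b $ t" "d' $ t + b' $ t < d $ t + b $ t" for t
    using f[of t] that unfolding exchangeable_def by (metis add.commute)
  have fill: "f t (d $ t - 1) (b $ t + 1) + f t (d' $ t + 1) (b' $ t - 1)
       \<le> f t (d $ t) (b $ t) + f t (d' $ t) (b' $ t)"
    if "d' $ t < d $ t" "b $ t < b' $ t" for t
    using f[of t] that unfolding exchangeable_def by blast
  have empty: "f t (d $ t + 1) (b $ t - 1) + f t (d' $ t - 1) (b' $ t + 1)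
       \<le> f t (d $ t) (b $ t) + f t (d' $ t) (b' $ t)"
    if "d $ t < d' $ t" "b' $ t < b $ t" for t
    using f[of t] that unfolding exchangeable_def by (metis add.commute)
  obtain h where h: "d' $ h < d $ h"
    using exists_greater_if_sum_eq[OF sum_d i(1)] by blast
  show ?thesis
  proof (cases "d' $ h + b' $ h < d $ h + b $ h")
    case True
    have "exchange_direction f d b d' b' (axis i 1 - axis h 1) 0"
      unfolding exchange_direction_def
      using i h True dock[of i] dock'[of h] by (auto simp: axis_def intro!: exI[of _ i])
    with True show ?thesis by blast
  next
    case False
    with h have bh: "b $ h < b' $ h" by linarith
    obtain j where j: "b' $ j < b $ j"
      using exists_greater_if_sum_eq[OF sum_b bh] by blast
    show ?thesis
    proof (cases "d' $ j + b' $ j < d $ j + b $ j")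
      case True
      have "exchange_direction f d b d' b' (axis i 1 - axis h 1) (axis h 1 - axis j 1)"
        unfolding exchange_direction_def
        using i h bh j True dock[of i] fill[of h] bike'[of j]
        by (auto simp: axis_def intro!: exI[of _ j])
      with True show ?thesis by blast
    next
      case False
      then have "exchange_direction f d b d' b' (axis j 1 - axis h 1) (axis h 1 - axis j 1)"
        unfolding exchange_direction_def
        using h bh j fill[of h] empty[of j] by (auto simp: axis_def intro!: exI[of _ j])
      then show ?thesis by blast
    qed
  qed
qed

definition total_cost :: "('n::finite \<Rightarrow> int \<Rightarrow> int \<Rightarrow> ennreal) \<Rightarrow> 'n alloc \<Rightarrow> ennreal" where
  "total_cost f = (\<lambda>(d, b). \<Sum>i\<in>UNIV. f i (d $ i) (b $ i))"

text \<open>Twice the dock-move distance; the factor keeps all computations in the integers.\<close>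

definition dock_difference :: "('n::finite) alloc \<Rightarrow> 'n alloc \<Rightarrow> int" where
  "dock_difference x y = (\<Sum>i\<in>UNIV. \<bar>dock_total x $ i - dock_total y $ i\<bar>)"

text \<open>
  Unlike the dock-move distance, this one also decreases under exchanges that leave the dock totals
  unchanged; it is the measure for the induction that moves \<open>y\<close> towards \<open>x\<close>.
\<close>

definition alloc_difference :: "('n::finite) alloc \<Rightarrow> 'n alloc \<Rightarrow> int" where
  "alloc_difference x y = (\<Sum>i\<in>UNIV. \<bar>fst x $ i - fst y $ i\<bar> + \<bar>snd x $ i - snd y $ i\<bar>)"

lemma sum_axis: "(\<Sum>t\<in>UNIV. axis i (1::int) $ (t::'n::finite)) = 1"
  by (simp add: axis_def)

text \<open>
  Interchanging open docks and bikes turns the chain that starts with an open dock into the one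
  that starts with a bike, and the moves \<open>o\<close>, \<open>O\<close> into \<open>e\<close>, \<open>E\<close>. Since station \<open>i\<close> gains a dock, it is
  the second index of the dock-move.
\<close>

lemma allocation_exchange:
  fixes x y :: "('n::finite) alloc"
  assumes f: "\<And>t. exchangeable (f t)"
    and x: "x \<in> allocations D B" and y: "y \<in> allocations D B"
    and i: "dock_total x $ i < dock_total y $ i"
  obtains x' y' where
    "total_cost f x' + total_cost f y' \<le> total_cost f x + total_cost f y"
    "x' \<in> allocations D B" "y' \<in> allocations D B"
    "alloc_difference y' x < alloc_difference y x"
    "dock_total x' = dock_total x \<and> dock_total y' = dock_total y \<or>
     (\<exists>j. dock_total y $ j < dock_total x $ j \<and>
        dock_total x' = dock_total x + axis i 1 - axis j 1 \<and>
        dock_total y' = dock_total y - axis i 1 + axis j 1 \<and> x' \<in> neighborhood D B x)"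
proof -
  obtain d b d' b' where xy: "x = (d, b)" "y = (d', b')"
    by (cases x, cases y)
  have sums: "(\<Sum>t\<in>UNIV. d $ t) = (\<Sum>t\<in>UNIV. d' $ t)"
    "(\<Sum>t\<in>UNIV. b $ t) = (\<Sum>t\<in>UNIV. b' $ t)"
    using x y by (auto simp: xy allocations_def sum.distrib)
  have i': "d $ i + b $ i < d' $ i + b' $ i"
    using i by (simp add: xy dock_total_def)
  define shape where "shape \<alpha> \<beta> \<longleftrightarrow>
     (\<exists>j h. \<alpha> = axis j 1 - axis h 1 \<and> \<beta> = axis h 1 - axis j 1) \<or>
     (\<exists>j. d' $ j + b' $ j < d $ j + b $ j \<and>
       (\<alpha> = axis i 1 - axis j 1 \<and> \<beta> = 0 \<or>
        (\<exists>h. \<alpha> = axis i 1 - axis h 1 \<and> \<beta> = axis h 1 - axis j 1)))"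
    for \<alpha> \<beta> :: "int ^ 'n"
  obtain \<alpha> \<beta> where dir: "exchange_direction f d b d' b' \<alpha> \<beta>" and shape: "shape \<alpha> \<beta> \<or> shape \<beta> \<alpha>"
  proof (cases "d $ i < d' $ i")
    case True
    have "\<exists>\<alpha> \<beta>. exchange_direction f d b d' b' \<alpha> \<beta> \<and> shape \<alpha> \<beta>"
      using exchange_from_open_dock[of f, OF f sums True i'] unfolding shape_def .
    then show thesis
      using that by (elim exE conjE) (metis (no_types))
  next
    case False
    with i' have "b $ i < b' $ i" by linarith
    from exchange_from_open_dock[of "\<lambda>t d b. f t b d",
        OF exchangeable_swap[OF f] sums(2,1) this]
    have "\<exists>\<alpha> \<beta>. exchange_direction f d b d' b' \<beta> \<alpha> \<and> shape \<alpha> \<beta>"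
      unfolding shape_def exchange_direction_swap[of f] using i' by (simp add: add.commute)
    then show thesis
      using that by (elim exE conjE) (metis (no_types))
  qed
  let ?x' = "(d + \<alpha>, b + \<beta>)" and ?y' = "(d' - \<alpha>, b' - \<beta>)"
  have zero: "(\<Sum>t\<in>UNIV. \<alpha> $ t) = 0" "(\<Sum>t\<in>UNIV. \<beta> $ t) = 0"
    using shape by (auto simp: shape_def sum_subtractf sum_axis)
  show thesis
  proof (rule that[of ?x' ?y'])
    show "total_cost f ?x' + total_cost f ?y' \<le> total_cost f x + total_cost f y"
      using dir unfolding total_cost_def xy exchange_direction_def prod.case sum.distrib[symmetric]
      by (intro sum_mono) simp
    show x'_alloc: "?x' \<in> allocations D B" "?y' \<in> allocations D B"
      using x y zero by (simp_all add: xy allocations_def sum.distrib sum_subtractf)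
    show "alloc_difference ?y' x < alloc_difference y x"
      using dir unfolding alloc_difference_def xy exchange_direction_def
      by (intro sum_strict_mono_ex1) auto
    have "(\<exists>j. dock_total y $ j < dock_total x $ j \<and>
        dock_total ?x' = dock_total x + axis i 1 - axis j 1 \<and>
        dock_total ?y' = dock_total y - axis i 1 + axis j 1 \<and> ?x' \<in> neighborhood D B x)"
      if j: "d' $ j + b' $ j < d $ j + b $ j"
        and move: "\<alpha> = axis i 1 - axis j 1 \<and> \<beta> = 0 \<or> \<beta> = axis i 1 - axis j 1 \<and> \<alpha> = 0 \<or>
         (\<exists>h. \<alpha> = axis i 1 - axis h 1 \<and> \<beta> = axis h 1 - axis j 1) \<or>
         (\<exists>h. \<beta> = axis i 1 - axis h 1 \<and> \<alpha> = axis h 1 - axis j 1)" for j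
    proof (intro exI[of _ j] conjI)
      have "i \<noteq> j" using i' j by auto
      have "?x' = move_o j i x \<or> ?x' = move_e j i x \<or>
          (\<exists>h. ?x' = move_E j i h x \<or> ?x' = move_O j i h x)"
        using move unfolding xy move_o_def move_e_def move_E_def move_O_def
        by (auto simp: algebra_simps)
      then show "?x' \<in> neighborhood D B x"
        unfolding neighborhood_def using x'_alloc \<open>i \<noteq> j\<close>
        by (intro CollectI conjI exI[of _ j] exI[of _ i]) auto
      show "dock_total y $ j < dock_total x $ j"
        using j by (simp add: xy dock_total_def)
      show "dock_total ?x' = dock_total x + axis i 1 - axis j 1"
        "dock_total ?y' = dock_total y - axis i 1 + axis j 1"
        using move by (auto simp: xy dock_total_def)
    qed
    moreover have "dock_total ?x' = dock_total x \<and> dock_total ?y' = dock_total y"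
      if "\<alpha> = axis j 1 - axis h 1 \<and> \<beta> = axis h 1 - axis j 1" for j h
      using that by (auto simp: xy dock_total_def)
    ultimately show "dock_total ?x' = dock_total x \<and> dock_total ?y' = dock_total y \<or>
     (\<exists>j. dock_total y $ j < dock_total x $ j \<and>
        dock_total ?x' = dock_total x + axis i 1 - axis j 1 \<and>
        dock_total ?y' = dock_total y - axis i 1 + axis j 1 \<and> ?x' \<in> neighborhood D B x)"
      using shape unfolding shape_def by (elim disjE exE conjE) blast+
  qed
qed

section \<open>Growing the ball by one dock-move\<close>

lemma sum_pos_part:
  fixes v :: "'n::finite \<Rightarrow> int"
  shows "sum v UNIV = 0 \<Longrightarrow> (\<Sum>t\<in>UNIV. \<bar>v t\<bar>) = 2 * (\<Sum>t\<in>UNIV. max 0 (v t))"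
proof -
  have "(\<Sum>t\<in>UNIV. \<bar>v t\<bar>) + sum v UNIV = 2 * (\<Sum>t\<in>UNIV. max 0 (v t))"
    unfolding sum_distrib_left sum.distrib[symmetric] by (rule sum.cong) auto
  then show "sum v UNIV = 0 \<Longrightarrow> ?thesis" by simp
qed

lemma sum_dock_total: "x \<in> allocations D B \<Longrightarrow> (\<Sum>t\<in>UNIV. dock_total x $ t) = int (D + B)"
  by (auto simp: allocations_def dock_total_def)

text \<open>
  The main step. Finiteness of the cost of \<open>x\<close> is what allows it to be cancelled from the exchange
  inequality.
\<close>

lemma neighborhood_improves_ball:
  fixes x x0 y :: "('n::finite) alloc"
  assumes f: "\<And>t. exchangeable (f t)"
    and x0: "x0 \<in> allocations D B" and x: "x \<in> allocations D B"
    and fin: "total_cost f x < \<infinity>"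
    and xr: "dock_difference x0 x \<le> 2 * int r"
    and opt: "\<And>w. w \<in> allocations D B \<Longrightarrow> dock_difference x0 w \<le> 2 * int r \<Longrightarrow>
               total_cost f x \<le> total_cost f w"
    and y: "y \<in> allocations D B" "dock_difference x0 y \<le> 2 * int r + 2"
  shows "\<exists>w \<in> insert x (neighborhood D B x). total_cost f w \<le> total_cost f y"
  using y
proof (induction "nat (alloc_difference y x)" arbitrary: y rule: less_induct)
  case (less y)
  let ?home = "\<lambda>t. dock_total x0 $ t" and ?current = "\<lambda>t. dock_total x $ t"
    and ?target = "\<lambda>t. dock_total y $ t"
  have cancel: "c \<le> c'" if "total_cost f x \<le> a" "a + c \<le> total_cost f x + c'" for a c c' :: ennreal
  proof -
    have "total_cost f x + c \<le> a + c"
      using that(1) by (rule add_right_mono)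
    also note that(2)
    finally have "total_cost f x + c \<le> total_cost f x + c'" .
    then show ?thesis
      using fin by (auto simp: ennreal_add_left_cancel_le)
  qed
  show ?case
  proof (cases "dock_difference x0 y \<le> 2 * int r")
    case True
    with opt less.prems(1) have "total_cost f x \<le> total_cost f y"
      by simp
    then show ?thesis by blast
  next
    case False
    \<comment> \<open>All allocations have the same number of docks, so half of each distance consists of gains.\<close>
    have "(\<Sum>t\<in>UNIV. max 0 (?current t - ?home t)) < (\<Sum>t\<in>UNIV. max 0 (?target t - ?home t))"
      using False xr sum_pos_part[of "\<lambda>t. ?current t - ?home t"] sum_pos_part[of "\<lambda>t. ?target t - ?home t"]
        sum_dock_total[OF x0] sum_dock_total[OF x] sum_dock_total[OF less.prems(1)]
      by (simp add: dock_difference_def sum_subtractf abs_minus_commute)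
    then obtain i where "max 0 (?current i - ?home i) < max 0 (?target i - ?home i)"
      by (elim exists_less_if_sum_less[THEN exE])
    then have i: "?home i < ?target i" "?current i < ?target i"
      by linarith+
    obtain x' y' where
      le: "total_cost f x' + total_cost f y' \<le> total_cost f x + total_cost f y" and
      alloc: "x' \<in> allocations D B" "y' \<in> allocations D B" and
      closer: "alloc_difference y' x < alloc_difference y x" and
      cases: "dock_total x' = dock_total x \<and> dock_total y' = dock_total y \<or>
       (\<exists>j. ?target j < ?current j \<and>
        dock_total x' = dock_total x + axis i 1 - axis j 1 \<and>
        dock_total y' = dock_total y - axis i 1 + axis j 1 \<and> x' \<in> neighborhood D B x)"
      by (rule allocation_exchange[of f, OF f x less.prems(1) i(2)])
    have nonneg: "0 \<le> alloc_difference w x" for w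
      by (auto simp: alloc_difference_def intro!: sum_nonneg)
    have recurse: ?thesis
      if x': "dock_difference x0 x' \<le> 2 * int r" and y': "dock_difference x0 y' \<le> 2 * int r + 2"
    proof -
      have "nat (alloc_difference y' x) < nat (alloc_difference y x)"
        using closer nonneg[of y'] by simp
      from less.hyps[OF this alloc(2) y'] obtain w
        where w: "w \<in> insert x (neighborhood D B x)" "total_cost f w \<le> total_cost f y'"
        by (elim bexE)
      note w(2)
      also have "total_cost f y' \<le> total_cost f y"
        using cancel[OF opt[OF alloc(1) x'] le] .
      finally show ?thesis
        using w(1) by (rule bexI)
    qed
    from cases show ?thesis
    proof (elim disjE exE conjE)
      assume "dock_total x' = dock_total x" "dock_total y' = dock_total y"
      then show ?thesis
        using recurse xr less.prems(2) by (simp add: dock_difference_def)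
    next
      fix j
      assume j: "?target j < ?current j" and x': "dock_total x' = dock_total x + axis i 1 - axis j 1"
        and y': "dock_total y' = dock_total y - axis i 1 + axis j 1"
        and nb: "x' \<in> neighborhood D B x"
      have "i \<noteq> j" using i j by auto
      show ?thesis
      proof (cases "?target j < ?home j")
        case True
        \<comment> \<open>Both stations of \<open>y\<close> move towards the initial allocation: \<open>y'\<close> is in the smaller ball.\<close>
        have "dock_difference x0 y' = (\<Sum>t\<in>UNIV. \<bar>?home t - ?target t\<bar> - axis i 1 $ t - axis j 1 $ t)"
          unfolding dock_difference_def y'
          using i True \<open>i \<noteq> j\<close> by (intro sum.cong) (auto simp: axis_def)
        then have "dock_difference x0 y' \<le> 2 * int r"
          using less.prems(2) by (simp add: dock_difference_def sum_subtractf sum_axis)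
        from opt[OF alloc(2) this] have "total_cost f x' \<le> total_cost f y"
          by (rule cancel) (use le in \<open>simp add: add.commute\<close>)
        then show ?thesis using nb by blast
      next
        case False
        \<comment> \<open>Here \<open>x\<close> has more docks at \<open>j\<close> than initially, so the loss there offsets the gain at \<open>i\<close>.\<close>
        have "dock_difference x0 y' \<le> (\<Sum>t\<in>UNIV. \<bar>?home t - ?target t\<bar> - axis i 1 $ t + axis j 1 $ t)"
          unfolding dock_difference_def y'
          using i \<open>i \<noteq> j\<close> by (intro sum_mono) (auto simp: axis_def)
        moreover have "dock_difference x0 x' \<le>
            (\<Sum>t\<in>UNIV. \<bar>?home t - ?current t\<bar> + axis i 1 $ t - axis j 1 $ t)"
          unfolding dock_difference_def x'
          using j False \<open>i \<noteq> j\<close> by (intro sum_mono) (auto simp: axis_def)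
        ultimately show ?thesis
          using xr less.prems(2)
          by (intro recurse) (simp_all add: dock_difference_def sum_subtractf sum.distrib sum_axis)
      qed
    qed
  qed
qed

section \<open>The run of the algorithm\<close>

lemma finite_neighborhood: "finite (neighborhood D B (x :: ('n::finite) alloc))"
proof -
  have "neighborhood D B x \<subseteq> range (\<lambda>(i, j). move_o i j x) \<union> range (\<lambda>(i, j). move_e i j x) \<union>
     range (\<lambda>(i, j, h). move_E i j h x) \<union> range (\<lambda>(i, j, h). move_O i j h x)"
    unfolding neighborhood_def by (auto simp: image_iff) metis+
  then show ?thesis
    by (rule finite_subset) simp
qed

lemma dock_difference_neighborhood:
  assumes "y \<in> neighborhood D B x"
  shows "dock_difference x0 y \<le> dock_difference x0 x + 2"
proof -
  from assms obtain i j where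
    "y = move_o i j x \<or> y = move_e i j x \<or> (\<exists>h. y = move_E i j h x \<or> y = move_O i j h x)"
    unfolding neighborhood_def by blast
  then have ij: "dock_total y = dock_total x - axis i 1 + axis j 1"
    by (cases x)
      (auto simp: dock_total_def move_o_def move_e_def move_E_def move_O_def algebra_simps)
  have "dock_difference x0 y \<le>
     (\<Sum>t\<in>UNIV. \<bar>dock_total x0 $ t - dock_total x $ t\<bar> + axis i 1 $ t + axis j 1 $ t)"
    unfolding dock_difference_def ij by (intro sum_mono) (auto simp: axis_def)
  then show ?thesis
    by (simp add: dock_difference_def sum.distrib sum_axis)
qed

lemma dock_move_distance_le_iff:
  "dock_move_distance x y \<le> real r \<longleftrightarrow> dock_difference x y \<le> 2 * int r"
  unfolding dock_move_distance_def dock_difference_def[symmetric] by linarith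

text \<open>
  Being optimal in the ball of radius \<open>r\<close> is the invariant of the run. It starts with radius 0,
  where it is bike-optimality, and is preserved because the ball of radius \<open>r + 1\<close> contains \<open>N(x r)\<close>.
  If no neighbor improves \<open>x r\<close>, then \<open>x r\<close> itself is optimal in the larger ball.
\<close>

lemma gradient_descent_optimal:
  fixes x0 :: "('n::finite) alloc"
  assumes f: "\<And>t. exchangeable (f t)"
    and x0: "x0 \<in> allocations D B" and fin: "total_cost f x0 < \<infinity>"
    and run: "gradient_descent_run (total_cost f) D B x0 z x"
    and "r \<le> z"
  shows "is_arg_min (total_cost f)
     (\<lambda>y. y \<in> allocations D B \<and> dock_difference x0 y \<le> 2 * int r) (x r)"
  using \<open>r \<le> z\<close>
proof (induction r)
  case 0
  have "dock_difference x0 y \<le> 0 \<longleftrightarrow> dock_total y = dock_total x0" for y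
  proof -
    have "dock_difference x0 y \<le> 0 \<longleftrightarrow> dock_difference x0 y = 0"
      by (auto simp: dock_difference_def sum_nonneg order_antisym)
    also have "\<dots> \<longleftrightarrow> dock_total y = dock_total x0"
      by (auto simp: dock_difference_def sum_nonneg_eq_0_iff vec_eq_iff)
    finally show ?thesis .
  qed
  then show ?case
    using run by (auto simp: gradient_descent_run_def bike_optimal_def)
next
  case (Suc r)
  have IH: "x r \<in> allocations D B" "dock_difference x0 (x r) \<le> 2 * int r"
    and opt: "\<And>w. w \<in> allocations D B \<Longrightarrow> dock_difference x0 w \<le> 2 * int r \<Longrightarrow>
               total_cost f (x r) \<le> total_cost f w"
    using Suc by (auto simp: is_arg_min_linorder)
  have "total_cost f (x r) \<le> total_cost f x0"
    by (rule opt[OF x0]) (simp add: dock_difference_def)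
  with fin have "total_cost f (x r) < \<infinity>"
    by (rule le_less_trans[rotated])
  then have improve: "\<exists>w \<in> insert (x r) (neighborhood D B (x r)). total_cost f w \<le> total_cost f y"
    if "y \<in> allocations D B" "dock_difference x0 y \<le> 2 * int r + 2" for y
    by (rule neighborhood_improves_ball[of f, OF f x0 IH(1) _ IH(2) _ that]) (rule opt)
  have step: "descent_step (total_cost f) D B (x r) (x (Suc r))"
    using run Suc.prems by (force simp: gradient_descent_run_def)
  have "x (Suc r) \<in> insert (x r) (neighborhood D B (x r)) \<and>
    (\<forall>w \<in> insert (x r) (neighborhood D B (x r)). total_cost f (x (Suc r)) \<le> total_cost f w)"
  proof (cases "\<exists>w \<in> neighborhood D B (x r). total_cost f w < total_cost f (x r)")
    case True
    then obtain w where w: "w \<in> neighborhood D B (x r)" "total_cost f w < total_cost f (x r)"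
      by blast
    obtain v where v: "is_arg_min (total_cost f) (\<lambda>w. w \<in> neighborhood D B (x r)) v"
      using ex_is_arg_min_if_finite[OF finite_neighborhood, of D B "x r" "total_cost f"] w(1)
      by blast
    have "total_cost f v \<le> total_cost f w"
      using v w(1) by (simp add: is_arg_min_linorder del: split_paired_All)
    with w(2) have "total_cost f v < total_cost f (x r)"
      by simp
    with v have "\<exists>y'. is_arg_min (total_cost f) (\<lambda>w. w \<in> neighborhood D B (x r)) y' \<and>
        total_cost f y' < total_cost f (x r)"
      by blast
    with step have "is_arg_min (total_cost f) (\<lambda>w. w \<in> neighborhood D B (x r)) (x (Suc r))"
      "total_cost f (x (Suc r)) < total_cost f (x r)"
      unfolding descent_step_def by (simp_all only: if_True)
    then show ?thesis
      by (simp add: is_arg_min_linorder del: split_paired_All)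
  next
    case False
    then have "x (Suc r) = x r"
      using step by (auto simp: descent_step_def is_arg_min_linorder split: if_splits)
    with False show ?thesis by (auto simp: not_less)
  qed
  then have best: "x (Suc r) \<in> insert (x r) (neighborhood D B (x r))"
    "\<And>w. w \<in> insert (x r) (neighborhood D B (x r)) \<Longrightarrow> total_cost f (x (Suc r)) \<le> total_cost f w"
    by blast+
  have "x (Suc r) \<in> allocations D B"
    using best(1) IH(1) by (auto simp: neighborhood_def)
  moreover have "dock_difference x0 (x (Suc r)) \<le> 2 * int (Suc r)"
    using best(1) IH(2) dock_difference_neighborhood[of "x (Suc r)" D B "x r" x0] by auto
  moreover have "total_cost f (x (Suc r)) \<le> total_cost f y"
    if y: "y \<in> allocations D B" "dock_difference x0 y \<le> 2 * int (Suc r)" for y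
  proof -
    have "dock_difference x0 y \<le> 2 * int r + 2"
      using y(2) by simp
    from improve[OF y(1) this] obtain w
      where "w \<in> insert (x r) (neighborhood D B (x r))" "total_cost f w \<le> total_cost f y"
      by (elim bexE)
    then show ?thesis
      using best(2)[of w] by simp
  qed
  ultimately show ?case
    by (simp add: is_arg_min_linorder)
qed

theorem theorem1:
  fixes p :: "'n::finite \<Rightarrow> int list pmf"
    and l u :: "'n \<Rightarrow> int"
    and depot :: "'n option"
    and D B z :: nat
    and x0 :: "'n alloc"
    and x :: "nat \<Rightarrow> 'n alloc"
  assumes "\<And>i X. X \<in> set_pmf (p i) \<Longrightarrow> set X \<subseteq> {1, -1}"
    and "\<And>i. 0 \<le> l i \<and> l i \<le> u i"
    and "x0 \<in> allocations D B"
    and "objective p l u depot x0 < \<infinity>"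
    and "0 < z"
    and "gradient_descent_run (objective p l u depot) D B x0 z x"
  shows "\<forall>r\<in>{1..z}.
    is_arg_min (objective p l u depot)
      (\<lambda>y. y \<in> allocations D B \<and> dock_move_distance x0 y \<le> real r) (x r)"
proof -
  define f where "f i = (if depot = Some i then depot_cost (l i) (u i)
      else station_cost (p i) (l i) (u i))" for i
  have obj: "objective p l u depot = total_cost f"
    by (auto simp: objective_def total_cost_def f_def fun_eq_iff intro!: sum.cong)
  have "exchangeable (f i)" for i
    using assms(1) by (simp add: f_def exchangeable_depot_cost exchangeable_station_cost)
  from gradient_descent_optimal[OF this assms(3) assms(4)[unfolded obj] assms(6)[unfolded obj]]
  show ?thesis
    by (simp add: obj dock_move_distance_le_iff)
qed

end
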